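(* Let $(X,\mu,T)$ be a rank-one measure-preserving transformation, with towers of bases $B_n$ and heights $h_n$, and let $I_{m,n}=\{i : 0\le i<h_n,\ T^i(B_n)\subseteq B_m\}$ for $n\ge m$. The following are equivalent. (1) $T$ factors onto some finite cyclic permutation, i.e. onto $\mathbb{Z}/k\mathbb{Z}$ for some $k\in\mathbb{N}$ with $k>1$. (2) There exists $k\in\mathbb{N}$ with $k>1$ such that for every real $\eta>0$ there exists $N\in\mathbb{N}$ such that for all $n\ge m\ge N$ there exists $j\in\mathbb{Z}/k\mathbb{Z}=\{0,1,\dots,k-1\}$ with $$\frac{|\{i\in I_{m,n} : [i]_k\neq j\}|}{|I_{m,n}|}<\eta .$$
   Context: $\mathbb{N}=\{0,1,2,\dots\}$. For $k>1$ and $n\in\mathbb{N}$, $[n]_k$ denotes the unique $m\in\{0,\dots,k-1\}$ with $n\equiv m \pmod k$. Measure-preserving transformations. $(X,\mu)$ is a standard Lebesgue probability space, nonatomic unless stated otherwise. A map $\phi:(X,\mu)\to(Y,\nu)$ is measure-preserving if for all measurable $A\subseteq Y$, $\phi^{-1}(A)$ is measurable and $\mu(\phi^{-1}(A))=\nu(A)$. A (measure-preserving) transformation $T:(X,\mu)\to(X,\mu)$ is a measure-preserving map that is invertible on a set of full measure and whose inverse is measure-preserving. A factor map from $(X,\mu,T)$ to $(Y,\nu,S)$ is a measure-preserving map $\phi:(X,\mu)\to(Y,\nu)$ (defined on a set of full measure) with $\phi(T(x))=S(\phi(x))$ for $\mu$-almost every $x$; $T$ factors onto $S$ if such a map exists.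 Finite cyclic permutations. For $k>1$, $\mathbb{Z}/k\mathbb{Z}$ denotes the system $(X_k,\mu_k,f_k)$ with $X_k=\{0,1,\dots,k-1\}$, $\mu_k$ giving each point measure $1/k$, and $f_k(i)=[i+1]_k$ (here the measure is atomic). These systems are called finite cyclic permutations. Rank-one transformations. A measure-preserving transformation $T$ on a nonatomic standard Lebesgue probability space $(X,\mu)$ is rank-one if there exist integers $r_n>1$ ($n\in\mathbb{N}$) and nonnegative integers $s_{n,i}$ ($n\in\mathbb{N}$, $0<i\le r_n$) such that, with $h_0=1$ and $h_{n+1}=r_nh_n+\sum_{0<i\le r_n}s_{n,i}$, we have $\sum_{n=0}^\infty \frac{h_{n+1}-r_nh_n}{h_{n+1}}<\infty$, and there are measurable subsets $B_n$, $B_{n,i}$ ($0<i\le r_n$), and $C_{n,i,j}$ ($0<i\le r_n$, $0<j\le s_{n,i}$) of $X$ such that for all $n$: - $\{B_{n,i}:0<i\le r_n\}$ is a partition of $B_n$; - the sets $T^k(B_n)$, $0\le k<h_n$, are disjoint; - $T^{h_n}(B_{n,i})=C_{n,i,1}$ if $s_{n,i}\ne0$ and $i\le r_n$; - $T^{h_n}(B_{n,i})=B_{n,i+1}$ if $s_{n,i}=0$ and $i<r_n$; - $T(C_{n,i,j})=C_{n,i,j+1}$ if $j<s_{n,i}$; - $T(C_{n,i,s_{n,i}})=B_{n,i+1}$ if $i<r_n$ (and $s_{n,i}\neq 0$); - $B_{n+1}=B_{n,1}$; and the collection $\bigcup_{n}\{B_n,T(B_n),\dots,T^{h_n-1}(B_n)\}$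 is dense in the $\sigma$-algebra of $\mu$-measurable sets, i.e. every measurable set can be approximated arbitrarily well in measure (of the symmetric difference) by finite unions of these sets. When a rank-one transformation is given, such data are fixed. The collection $\{B_n,\dots,T^{h_n-1}(B_n)\}$ is the stage-$n$ tower, with base $B_n$, height $h_n$, and levels $T^k(B_n)$. For $n\ge m$, $B_m$ is the disjoint union of the levels $T^i(B_n)$, $i\in I_{m,n}$; the finite sets $I_{m,n}$ are determined by the cutting parameter $(r_n)$ and the spacer parameter $(s_{n,i})$. *)

theory Defs
  imports "HOL-Probability.Probability"
begin

definition measure_preserving :: "'a measure \<Rightarrow> 'b measure \<Rightarrow> ('a \<Rightarrow> 'b) \<Rightarrow> bool" where
  "measure_preserving M N f \<longleftrightarrow>
     f \<in> measurable M N \<and>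
     (\<forall>A\<in>sets N. emeasure M (f -` A \<inter> space M) = emeasure N A)"

definition full_measure_set :: "'a measure \<Rightarrow> 'a set \<Rightarrow> bool" where
  "full_measure_set M A \<longleftrightarrow> A \<in> sets M \<and> emeasure M (space M - A) = 0"

definition isomorphism_mod_0 :: "'a measure \<Rightarrow> 'b measure \<Rightarrow> ('a \<Rightarrow> 'b) \<Rightarrow> bool" where
  "isomorphism_mod_0 M N f \<longleftrightarrow>
     (\<exists>A B. full_measure_set M A \<and> full_measure_set N B \<and> bij_betw f A B \<and>
        measure_preserving (restrict_space M A) (restrict_space N B) f \<and>
        measure_preserving (restrict_space N B) (restrict_space M A) (the_inv_into A f))"

text \<open>A nonatomic standard Lebesgue probability space is a complete probability space that is
  isomorphic modulo null sets to the unit interval with Lebesgue measure.\<close>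

definition nonatomic_standard_lebesgue :: "'a measure \<Rightarrow> bool" where
  "nonatomic_standard_lebesgue M \<longleftrightarrow>
     prob_space M \<and> complete_measure M \<and>
     (\<exists>f. isomorphism_mod_0 M (lebesgue_on {0..1::real}) f)"

text \<open>The second conjunct says that \<open>T\<close> is invertible on a set of full measure, with
  measure-preserving inverse.\<close>

definition mp_transformation :: "'a measure \<Rightarrow> ('a \<Rightarrow> 'a) \<Rightarrow> bool" where
  "mp_transformation M T \<longleftrightarrow> measure_preserving M M T \<and> isomorphism_mod_0 M M T"

text \<open>A factor map need only be defined on a set \<open>A\<close> of full measure; the values of the total
  function \<open>f\<close> outside \<open>A\<close> are irrelevant, since almost every \<open>x\<close> has both \<open>x\<close> and \<open>T x\<close> in \<open>A\<close>.\<close>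

definition factor_map ::
  "'a measure \<Rightarrow> ('a \<Rightarrow> 'a) \<Rightarrow> 'b measure \<Rightarrow> ('b \<Rightarrow> 'b) \<Rightarrow> ('a \<Rightarrow> 'b) \<Rightarrow> bool" where
  "factor_map M T N S f \<longleftrightarrow>
     (\<exists>A. full_measure_set M A \<and> measure_preserving (restrict_space M A) N f) \<and>
     (AE x in M. f (T x) = S (f x))"

definition factors_onto ::
  "'a measure \<Rightarrow> ('a \<Rightarrow> 'a) \<Rightarrow> 'b measure \<Rightarrow> ('b \<Rightarrow> 'b) \<Rightarrow> bool" where
  "factors_onto M T N S \<longleftrightarrow> (\<exists>f. factor_map M T N S f)"

definition cyclic_space :: "nat \<Rightarrow> nat measure" where
  "cyclic_space k = uniform_count_measure {0..<k}"

definition cyclic_perm :: "nat \<Rightarrow> nat \<Rightarrow> nat" where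
  "cyclic_perm k i = (i + 1) mod k"

primrec tower_height :: "(nat \<Rightarrow> nat) \<Rightarrow> (nat \<Rightarrow> nat \<Rightarrow> nat) \<Rightarrow> nat \<Rightarrow> nat" where
  "tower_height r s 0 = 1"
| "tower_height r s (Suc n) = r n * tower_height r s n + (\<Sum>i\<in>{1..r n}. s n i)"

definition tower_level :: "('a \<Rightarrow> 'a) \<Rightarrow> (nat \<Rightarrow> 'a set) \<Rightarrow> nat \<Rightarrow> nat \<Rightarrow> 'a set" where
  "tower_level T B n k = (T ^^ k) ` B n"

text \<open>A rank-one transformation together with its fixed data: cutting parameter \<open>r\<close>, spacer
  parameter \<open>s\<close>, bases \<open>B n\<close>, pieces \<open>P n i\<close> of the bases (the sets $B_{n,i}$) and spacer levels
  \<open>C n i j\<close>. The indices \<open>i\<close> and \<open>j\<close> start at 1.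
  Measurability of the levels is stated explicitly, because the image of a measurable set under a
  map that is invertible only almost everywhere need not be measurable.\<close>

locale rank_one_transformation =
  fixes M :: "'a measure"
    and T :: "'a \<Rightarrow> 'a"
    and r :: "nat \<Rightarrow> nat"
    and s :: "nat \<Rightarrow> nat \<Rightarrow> nat"
    and B :: "nat \<Rightarrow> 'a set"
    and P :: "nat \<Rightarrow> nat \<Rightarrow> 'a set"
    and C :: "nat \<Rightarrow> nat \<Rightarrow> nat \<Rightarrow> 'a set"
  assumes standard_lebesgue: "nonatomic_standard_lebesgue M"
    and transformation: "mp_transformation M T"
    and cuts: "\<And>n. r n > 1"
    and summable_spacers:
      "summable (\<lambda>n. (real (tower_height r s (Suc n)) - real (r n * tower_height r s n))
                       / real (tower_height r s (Suc n)))"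
    and base_measurable: "\<And>n. B n \<in> sets M"
    and piece_measurable: "\<And>n i. 0 < i \<Longrightarrow> i \<le> r n \<Longrightarrow> P n i \<in> sets M"
    and spacer_measurable:
      "\<And>n i j. 0 < i \<Longrightarrow> i \<le> r n \<Longrightarrow> 0 < j \<Longrightarrow> j \<le> s n i \<Longrightarrow> C n i j \<in> sets M"
    and level_measurable:
      "\<And>n k. k < tower_height r s n \<Longrightarrow> tower_level T B n k \<in> sets M"
    and pieces_disjoint: "\<And>n. disjoint_family_on (P n) {1..r n}"
    and pieces_union: "\<And>n. (\<Union>i\<in>{1..r n}. P n i) = B n"
    and levels_disjoint: "\<And>n. disjoint_family_on (tower_level T B n) {0..<tower_height r s n}"
    and top_to_spacer:
      "\<And>n i. 0 < i \<Longrightarrow> i \<le> r n \<Longrightarrow> s n i \<noteq> 0 \<Longrightarrow>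
         (T ^^ tower_height r s n) ` P n i = C n i 1"
    and top_to_next:
      "\<And>n i. 0 < i \<Longrightarrow> i < r n \<Longrightarrow> s n i = 0 \<Longrightarrow>
         (T ^^ tower_height r s n) ` P n i = P n (i + 1)"
    and spacer_to_spacer:
      "\<And>n i j. 0 < i \<Longrightarrow> i \<le> r n \<Longrightarrow> 0 < j \<Longrightarrow> j < s n i \<Longrightarrow> T ` C n i j = C n i (j + 1)"
    and spacer_to_next:
      "\<And>n i. 0 < i \<Longrightarrow> i < r n \<Longrightarrow> s n i \<noteq> 0 \<Longrightarrow> T ` C n i (s n i) = P n (i + 1)"
    and next_base: "\<And>n. B (Suc n) = P n 1"
    and levels_dense:
      "\<And>A \<epsilon>. A \<in> sets M \<Longrightarrow> \<epsilon> > 0 \<Longrightarrow>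
         \<exists>F. finite F \<and> F \<subseteq> {tower_level T B n k | n k. k < tower_height r s n} \<and>
             measure M (sym_diff A (\<Union>F)) < \<epsilon>"

text \<open>The index set $I_{m,n}$, intended for \<open>m \<le> n\<close>.\<close>

definition tower_indices ::
  "('a \<Rightarrow> 'a) \<Rightarrow> (nat \<Rightarrow> nat) \<Rightarrow> (nat \<Rightarrow> nat \<Rightarrow> nat) \<Rightarrow> (nat \<Rightarrow> 'a set) \<Rightarrow> nat \<Rightarrow> nat \<Rightarrow> nat set"
where
  "tower_indices T r s B m n =
     {i. i < tower_height r s n \<and> tower_level T B n i \<subseteq> B m}"

end

theory Submission
  imports Defs
begin

text \<open>
  Write $\mu$ for the measure and $L_{n,i}$ for the level $T^i(B_n)$. The levels of one stage are
  pairwise disjoint, they all have measure $\mu(B_n)$, and every level of stage $m$ is the disjoint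
  union of levels of any later stage $n$: precisely,
  $L_{m,l} = \bigcup_{i \in I_{m,n}} L_{n,i+l}$.

  A factor map onto $\mathbb{Z}/k\mathbb{Z}$ has fibres $D_0, \dots, D_{k-1}$, each the inverse
  image of its successor under $T$ up to a null set. For large $n$, the fibre $D_0$ is almost a
  union of levels of stage $n$. Up to null sets, $T^i$ carries the part of $B_n$ in $D_j$ onto
  the part of $L_{n,i}$ in $D_{j+i}$, so if no fibre contained most of $B_n$, every level would be split
  substantially between $D_0$ and its complement. Hence $B_n$ is concentrated in one fibre
  (\<open>base_concentrated\<close>). If $B_m$ is concentrated in $D_a$ and $B_n$ in $D_b$, then a level
  $L_{n,i} \subseteq B_m$ is concentrated in $D_{b+i}$, which forces $b + i \equiv a$ modulo $k$ for
  most $i \in I_{m,n}$ (\<open>indices_concentrated_of_cyclic_partition\<close>).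

  Conversely, suppose that most elements of $I_{m,n}$ lie in one residue class whenever $m \le n$
  are large. Along a sparse sequence of stages, colour a point of $L_{n,i}$ by the residue of $i$
  modulo $k$, shifted so that the colourings at consecutive stages of the sequence mostly agree. The
  points where they disagree, or where the colouring fails to advance by $1$ under $T$, have
  summable measure; by the Borel-Cantelli lemma the colourings converge almost everywhere, and the
  limit is a factor map (\<open>factor_if_indices_concentrated\<close>).

  Since $T$ is injective only off a null set, equality of the measures of the levels is not
  immediate: the image of a null set could be large. It follows from two consequences of the density
  of the levels, namely that the towers exhaust the space (\<open>tower_exhausts\<close>) and, the measure
  being nonatomic, that the levels become uniformly small (\<open>levels_small\<close>); see
  \<open>level_vimage_AE\<close>.
\<close>

section \<open>Measure-preserving maps, small covers and cyclic factors\<close>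

lemma measure_preserving_AE:
  assumes T: "measure_preserving M M T" and "AE x in M. Q x"
  shows "AE x in M. Q (T x)"
proof -
  obtain N where N: "{x \<in> space M. \<not> Q x} \<subseteq> N" "N \<in> sets M" "emeasure M N = 0"
    using assms(2) by (auto elim: AE_E)
  have m: "T \<in> measurable M M" using T by (simp add: measure_preserving_def)
  have "emeasure M (T -` N \<inter> space M) = 0"
    using T N by (simp add: measure_preserving_def)
  moreover have "{x \<in> space M. \<not> Q (T x)} \<subseteq> T -` N \<inter> space M"
    using N(1) measurable_space[OF m] by auto
  ultimately show ?thesis
    using measurable_sets[OF m N(2)] by (intro AE_I[where N="T -` N \<inter> space M"])
qed

lemma measure_preserving_measure_eq:
  assumes "prob_space M" and T: "measure_preserving M M T"
    and A: "A \<in> sets M" "A' \<in> sets M" and ae: "AE x in M. x \<in> A \<longleftrightarrow> T x \<in> A'"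
  shows "measure M A = measure M A'"
proof -
  interpret prob_space M by fact
  have m: "T \<in> measurable M M" using T by (simp add: measure_preserving_def)
  have "measure M A = measure M (T -` A' \<inter> space M)"
  proof (rule finite_measure_eq_AE)
    show "AE x in M. x \<in> A \<longleftrightarrow> x \<in> T -` A' \<inter> space M"
      using ae AE_space by eventually_elim auto
  qed (use A measurable_sets[OF m A(2)] in auto)
  also have "\<dots> = measure M A'"
    using T A by (simp add: measure_preserving_def measure_def)
  finally show ?thesis .
qed

lemma full_measure_set_AE:
  assumes "full_measure_set M A"
  shows "AE x in M. x \<in> A"
  using assms by (auto simp: full_measure_set_def intro!: AE_I[where N="space M - A"])

text \<open>The form in which nonatomicity is used: the space is covered, up to a null set, by $K$ sets of
  measure at most $1/K$, the inverse images of the intervals $[i/K, (i+1)/K]$.\<close>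

lemma standard_lebesgue_small_cover:
  assumes M: "nonatomic_standard_lebesgue M" and K: "K > (0::nat)"
  obtains A :: "nat \<Rightarrow> 'a set"
  where "\<And>i. i < K \<Longrightarrow> A i \<in> sets M" "\<And>i. i < K \<Longrightarrow> measure M (A i) \<le> 1 / K"
    "AE x in M. \<exists>i<K. x \<in> A i"
proof -
  interpret prob_space M using M by (simp add: nonatomic_standard_lebesgue_def)
  define U where "U = lebesgue_on {0..1::real}"
  obtain f where "isomorphism_mod_0 M U f"
    using M unfolding nonatomic_standard_lebesgue_def U_def by blast
  then obtain A0 B0 where A0: "full_measure_set M A0" and B0: "full_measure_set U B0"
    and bij: "bij_betw f A0 B0"
    and f: "measure_preserving (restrict_space M A0) (restrict_space U B0) f"
    unfolding isomorphism_mod_0_def by blast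
  have A0s: "A0 \<in> sets M" and B0s: "B0 \<in> sets U"
    using A0 B0 by (auto simp: full_measure_set_def)
  have spA: "space (restrict_space M A0) = A0"
    using A0s by (rule space_restrict_space2)
  have B01: "B0 \<subseteq> {0..1}" using sets.sets_into_space[OF B0s] by (simp add: U_def)
  have fm: "f \<in> measurable (restrict_space M A0) (restrict_space U B0)"
    using f by (simp add: measure_preserving_def)
  define A where "A i = f -` {real i / K .. real (Suc i) / K} \<inter> A0" for i
  have Ji: "{real i / K .. real (Suc i) / K} \<subseteq> {0..1}" if "i < K" for i
    using that K by (auto simp: field_simps intro: order_trans)
  have JU: "{real i / K .. real (Suc i) / K} \<in> sets U" if "i < K" for i
    unfolding U_def using Ji[OF that] by (subst sets_restrict_space_iff) auto
  have J: "B0 \<inter> {real i / K .. real (Suc i) / K} \<in> sets (restrict_space U B0)" if "i < K" for i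
    using JU[OF that] by (auto simp: sets_restrict_space)
  have Aeq: "A i = f -` (B0 \<inter> {real i / K .. real (Suc i) / K}) \<inter> space (restrict_space M A0)" for i
    unfolding A_def spA using bij by (auto simp: bij_betw_def)
  have As: "A i \<in> sets (restrict_space M A0)" if "i < K" for i
    unfolding Aeq using measurable_sets[OF fm J[OF that]] .
  have AM: "A i \<in> sets M" if "i < K" for i
    using As[OF that] A0s by (simp add: sets_restrict_space_iff)
  have "measure M (A i) \<le> 1 / K" if i: "i < K" for i
  proof -
    have "emeasure M (A i) = emeasure (restrict_space M A0) (A i)"
      using A0s by (subst emeasure_restrict_space) (auto simp: A_def)
    also have "\<dots> = emeasure (restrict_space U B0) (B0 \<inter> {real i / K .. real (Suc i) / K})"
      using f J[OF i] unfolding Aeq measure_preserving_def by blast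
    also have "\<dots> = emeasure U (B0 \<inter> {real i / K .. real (Suc i) / K})"
      using B0s by (subst emeasure_restrict_space) auto
    also have "\<dots> \<le> emeasure U {real i / K .. real (Suc i) / K}"
      using JU[OF i] by (intro emeasure_mono) auto
    also have "\<dots> = emeasure lebesgue {real i / K .. real (Suc i) / K}"
      unfolding U_def using Ji[OF i] by (subst emeasure_restrict_space) auto
    also have "\<dots> = ennreal (real (Suc i) / K - real i / K)"
      using K by (subst emeasure_completion) (auto simp: field_simps)
    also have "real (Suc i) / K - real i / K = 1 / K"
      using K by (simp add: field_simps)
    finally have "ennreal (measure M (A i)) \<le> ennreal (1 / K)"
      by (simp add: emeasure_eq_measure)
    then show ?thesis by (subst (asm) ennreal_le_iff) auto
  qed
  moreover have "\<exists>i<K. x \<in> A i" if x: "x \<in> A0" for x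
  proof -
    have fx: "0 \<le> f x" "f x \<le> 1" using bij x B01 by (auto simp: bij_betw_def)
    show ?thesis
    proof (cases "f x = 1")
      \<comment> \<open>The right end point lies in the last interval, not in the one with index \<open>K\<close>.\<close>
      case True
      then show ?thesis using x K
        by (intro exI[of _ "K - 1"]) (auto simp: A_def field_simps)
    next
      case False
      define i where "i = nat \<lfloor>f x * K\<rfloor>"
      have "0 \<le> f x * K" using fx by simp
      then have i: "real i \<le> f x * K" "f x * K < real i + 1"
        unfolding i_def by linarith+
      have "f x * K < K" using fx False K by simp
      then have "i < K" using i by linarith
      moreover have "x \<in> A i" using i x K by (auto simp: A_def field_simps)
      ultimately show ?thesis by blast
    qed
  qed
  then have "AE x in M. \<exists>i<K. x \<in> A i"
    by (rule eventually_mono[OF full_measure_set_AE[OF A0]])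
  ultimately show ?thesis using that[of A] AM by blast
qed

text \<open>An equivariant measurable map to the cycle is automatically measure-preserving: its fibres are
  permuted cyclically, so that they have the same measure.\<close>

lemma factors_onto_cyclicI:
  assumes "prob_space M" and T: "measure_preserving M M T" and k: "k > 0"
    and A: "full_measure_set M A"
    and f: "f \<in> measurable (restrict_space M A) (count_space {0..<k})"
    and ae: "AE x in M. f (T x) = cyclic_perm k (f x)"
  shows "factors_onto M T (cyclic_space k) (cyclic_perm k)"
proof -
  interpret prob_space M by fact
  define V where "V v = {x \<in> A. f x = v}" for v
  have As: "A \<in> sets M" using A by (simp add: full_measure_set_def)
  have spA: "space (restrict_space M A) = A"
    using As by (rule space_restrict_space2)
  have fk: "f x < k" if "x \<in> A" for x
    using measurable_space[OF f] that spA by auto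
  have Vs: "V v \<in> sets M" for v
  proof (cases "v < k")
    case True
    then have "f -` {v} \<inter> A \<in> sets (restrict_space M A)"
      using measurable_sets[OF f, of "{v}"] spA by auto
    then show ?thesis using As by (auto simp: sets_restrict_space_iff V_def vimage_def Int_def conj_commute)
  next
    case False
    then have "V v = {}" using fk by (auto simp: V_def)
    then show ?thesis by simp
  qed
  have aeA: "AE x in M. x \<in> A" by (rule full_measure_set_AE[OF A])
  have aeTA: "AE x in M. T x \<in> A" by (rule measure_preserving_AE[OF T aeA])
  have step: "measure M (V v) = measure M (V (Suc v))" if "Suc v < k" for v
  proof (rule measure_preserving_measure_eq[OF \<open>prob_space M\<close> T Vs Vs])
    show "AE x in M. x \<in> V v \<longleftrightarrow> T x \<in> V (Suc v)"
      using aeA aeTA ae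
    proof eventually_elim
      case (elim x)
      have "(f x + 1) mod k = Suc v \<longleftrightarrow> f x = v"
        using fk[OF elim(1)] that by (cases "f x + 1 = k") auto
      then show ?case using elim by (auto simp: V_def cyclic_perm_def)
    qed
  qed
  have V0: "measure M (V v) = measure M (V 0)" if "v < k" for v
    using that by (induction v) (auto simp: step[symmetric])
  have sumV: "measure M (\<Union>v\<in>S. V v) = card S * measure M (V 0)" if "S \<subseteq> {0..<k}" for S
  proof -
    have "finite S" using that finite_subset by blast
    then have "measure M (\<Union>v\<in>S. V v) = (\<Sum>v\<in>S. measure M (V v))"
      using Vs by (intro finite_measure_finite_Union) (auto simp: disjoint_family_on_def V_def)
    also have "\<dots> = (\<Sum>v\<in>S. measure M (V 0))"
      using that by (intro sum.cong refl V0) auto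
    finally show ?thesis by simp
  qed
  have "measure M (\<Union>v\<in>{0..<k}. V v) = 1"
  proof (subst prob_eq_1)
    show "AE x in M. x \<in> (\<Union>v\<in>{0..<k}. V v)"
      using aeA by eventually_elim (auto simp: V_def fk)
  qed (use Vs in auto)
  then have Vk: "measure M (V 0) = 1 / k" using sumV[of "{0..<k}"] k by (simp add: field_simps)
  have "measure_preserving (restrict_space M A) (cyclic_space k) f"
    unfolding measure_preserving_def
  proof (intro conjI ballI)
    show "f \<in> measurable (restrict_space M A) (cyclic_space k)"
      using f by (subst measurable_cong_sets[where N'="count_space {0..<k}"])
        (auto simp: cyclic_space_def sets_uniform_count_measure)
    fix S assume "S \<in> sets (cyclic_space k)"
    then have S: "S \<subseteq> {0..<k}" by (auto simp: cyclic_space_def sets_uniform_count_measure)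
    have eq: "f -` S \<inter> space (restrict_space M A) = (\<Union>v\<in>S. V v)"
      unfolding spA by (auto simp: V_def)
    have "emeasure (restrict_space M A) (\<Union>v\<in>S. V v) = emeasure M (\<Union>v\<in>S. V v)"
      using As by (subst emeasure_restrict_space) (auto simp: V_def)
    also have "\<dots> = ennreal (card S / k)"
      using sumV[OF S] Vk by (simp add: emeasure_eq_measure)
    also have "\<dots> = emeasure (cyclic_space k) S"
      using S k by (simp add: cyclic_space_def emeasure_uniform_count_measure)
    finally show "emeasure (restrict_space M A) (f -` S \<inter> space (restrict_space M A)) = emeasure (cyclic_space k) S"
      by (simp add: eq)
  qed
  then show ?thesis using A ae unfolding factors_onto_def factor_map_def by blast
qed

section \<open>Combinatorics of the towers\<close>

context rank_one_transformation
begin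

abbreviation "h \<equiv> tower_height r s"
abbreviation "L \<equiv> tower_level T B"

text \<open>The part of the space covered by the tower of stage \<open>n\<close>.\<close>

definition tower :: "nat \<Rightarrow> 'a set" where
  "tower n = (\<Union>k<h n. L n k)"

text \<open>The index, within the tower of stage $n+1$, of the level $B_{n,i}$ (see
  \<open>piece_eq_level\<close>): the sub-columns before it have $h_n + s_{n,l}$ levels each, for
  $1 \le l < i$.\<close>

definition offset :: "nat \<Rightarrow> nat \<Rightarrow> nat" where
  "offset n i = (\<Sum>l=1..<i. h n + s n l)"

lemma prob_space_M: "prob_space M"
  using standard_lebesgue by (simp add: nonatomic_standard_lebesgue_def)

lemma T_preserving: "measure_preserving M M T"
  using transformation by (simp add: mp_transformation_def)

lemma height_pos: "h n > 0"
  by (induction n) (use cuts in \<open>auto intro: order.strict_trans less_imp_le\<close>)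

lemma offset_bound:
  assumes "1 \<le> i" "i \<le> r n"
  shows "offset n i + h n \<le> h (Suc n)"
proof -
  have "offset n i + h n \<le> (\<Sum>l=1..<Suc i. h n + s n l)"
    using assms by (simp add: offset_def)
  also have "\<dots> \<le> (\<Sum>l\<in>{1..r n}. h n + s n l)"
    using assms by (intro sum_mono2) auto
  also have "\<dots> = h (Suc n)" by (simp add: sum.distrib)
  finally show ?thesis .
qed

lemma spacer_eq:
  assumes "1 \<le> i" "i \<le> r n" "1 \<le> j" "j \<le> s n i"
  shows "C n i j = (T ^^ (h n + (j - 1))) ` P n i"
  using assms(3,4)
proof (induction j rule: dec_induct)
  case base
  then show ?case using top_to_spacer[of i n] assms by auto
next
  case (step j)
  then have "C n i (Suc j) = T ` C n i j" using spacer_to_spacer[of i n j] assms by auto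
  also have "\<dots> = T ` (T ^^ (h n + (j - 1))) ` P n i" using step by simp
  also have "\<dots> = (T ^^ Suc (h n + (j - 1))) ` P n i" by (simp only: funpow.simps image_comp)
  also have "Suc (h n + (j - 1)) = h n + (Suc j - 1)" using step by simp
  finally show ?case .
qed

lemma next_piece:
  assumes "1 \<le> i" "i < r n"
  shows "P n (Suc i) = (T ^^ (h n + s n i)) ` P n i"
proof (cases "s n i = 0")
  case True
  then show ?thesis using top_to_next[of i n] assms by auto
next
  case False
  then have "P n (Suc i) = T ` C n i (s n i)" using spacer_to_next[of i n] assms by auto
  also have "\<dots> = T ` (T ^^ (h n + (s n i - 1))) ` P n i"
    using spacer_eq[of i n "s n i"] False assms by simp
  also have "\<dots> = (T ^^ Suc (h n + (s n i - 1))) ` P n i" by (simp only: funpow.simps image_comp)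
  also have "Suc (h n + (s n i - 1)) = h n + s n i" using False by simp
  finally show ?thesis .
qed

lemma piece_eq_level:
  assumes "1 \<le> i" "i \<le> r n"
  shows "P n i = L (Suc n) (offset n i)"
  using assms
proof (induction i rule: dec_induct)
  case base
  then show ?case by (simp add: offset_def tower_level_def next_base)
next
  case (step i)
  then have "P n (Suc i) = (T ^^ (h n + s n i)) ` (T ^^ offset n i) ` B (Suc n)"
    using next_piece[of i n] by (simp add: tower_level_def)
  also have "\<dots> = (T ^^ (h n + s n i + offset n i)) ` B (Suc n)"
    by (simp add: image_comp funpow_add)
  also have "h n + s n i + offset n i = offset n (Suc i)"
    using step by (simp add: offset_def)
  finally show ?case by (simp add: tower_level_def)
qed

lemma level_add: "(T ^^ l) ` L n k = L n (k + l)"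
  by (simp add: tower_level_def image_comp add.commute flip: funpow_add)

lemma level_0: "L n 0 = B n"
  by (simp add: tower_level_def)

text \<open>The bound on the indices says that above each copy of $B_m$ inside the tower of stage $n$ there
  is room for the whole tower of stage $m$. The index set is identified with $I_{m,n}$ in
  \<open>level_decomposition\<close>, once the bases are known to be nonempty.\<close>

lemma base_decomposition:
  assumes "m \<le> n"
  shows "\<exists>I. (\<forall>i\<in>I. i + h m \<le> h n) \<and> B m = (\<Union>i\<in>I. L n i)"
  using assms
proof (induction n rule: dec_induct)
  case base
  show ?case by (intro exI[of _ "{0}"]) (simp add: level_0)
next
  case (step n)
  then obtain I where I: "\<forall>i\<in>I. i + h m \<le> h n" "B m = (\<Union>i\<in>I. L n i)" by blast
  define J where "J = (\<lambda>(i, l). offset n l + i) ` (I \<times> {1..r n})"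
  have "L n i = (\<Union>l\<in>{1..r n}. L (Suc n) (offset n l + i))" for i
  proof -
    have "L n i = (\<Union>l\<in>{1..r n}. (T ^^ i) ` P n l)"
      unfolding tower_level_def pieces_union[of n, symmetric] by (simp add: image_UN)
    also have "\<dots> = (\<Union>l\<in>{1..r n}. L (Suc n) (offset n l + i))"
      by (intro SUP_cong) (auto simp: piece_eq_level level_add)
    finally show ?thesis .
  qed
  then have "B m = (\<Union>i\<in>J. L (Suc n) i)"
    unfolding I(2) J_def by auto
  moreover have "i + h m \<le> h (Suc n)" if "i \<in> J" for i
    using that I(1) offset_bound[of _ n] by (fastforce simp: J_def simp del: tower_height.simps)
  ultimately show ?case by blast
qed

lemma base_antimono: "m \<le> n \<Longrightarrow> B n \<subseteq> B m"
proof (induction n rule: dec_induct)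
  case (step n)
  have "P n 1 \<subseteq> B n" using pieces_union[of n] cuts[of n] by force
  then show ?case using step next_base[of n] by simp
qed simp

lemma level_unique:
  assumes "x \<in> L n i" "x \<in> L n j" "i < h n" "j < h n"
  shows "i = j"
  using levels_disjoint[of n] assms unfolding disjoint_family_on_def
  by (metis IntI atLeastLessThan_iff empty_iff le0)

lemma tower_sets [measurable]: "tower n \<in> sets M"
  unfolding tower_def using level_measurable by auto

lemma T_level: "x \<in> L n k \<Longrightarrow> T x \<in> L n (Suc k)"
  by (auto simp: tower_level_def)

lemma level_decomposition_exists:
  assumes "m \<le> n"
  shows "\<exists>I. (\<forall>i\<in>I. i + h m \<le> h n) \<and> (\<forall>k. L m k = (\<Union>i\<in>I. L n (i + k)))"
proof -
  obtain I where I: "\<forall>i\<in>I. i + h m \<le> h n" "B m = (\<Union>i\<in>I. L n i)"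
    using base_decomposition[OF assms] by blast
  have "L m k = (\<Union>i\<in>I. L n (i + k))" for k
  proof -
    have "L m k = (T ^^ k) ` (\<Union>i\<in>I. L n i)" by (simp add: tower_level_def I)
    also have "\<dots> = (\<Union>i\<in>I. L n (i + k))" by (simp add: image_UN level_add)
    finally show ?thesis .
  qed
  then show ?thesis using I by blast
qed

lemma tower_mono: "m \<le> n \<Longrightarrow> tower m \<subseteq> tower n"
proof
  fix x assume "m \<le> n" "x \<in> tower m"
  then obtain k I where "k < h m" "x \<in> L m k" and I: "\<forall>i\<in>I. i + h m \<le> h n"
    "\<forall>k. L m k = (\<Union>i\<in>I. L n (i + k))"
    using level_decomposition_exists[of m n] by (auto simp: tower_def)
  then obtain i where "i \<in> I" "x \<in> L n (i + k)" by blast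
  moreover have "i + k < h n" using I(1) \<open>i \<in> I\<close> \<open>k < h m\<close> by fastforce
  ultimately show "x \<in> tower n" by (auto simp: tower_def)
qed

section \<open>Consequences of density\<close>

text \<open>Unlike the density axiom, this gives approximations by levels of one prescribed stage, since
  levels of earlier stages are unions of levels of that stage.\<close>

lemma approximation_at_stage:
  assumes A: "A \<in> sets M" and e: "\<epsilon> > 0"
  shows "\<exists>N. \<forall>n\<ge>N. \<exists>S\<subseteq>{..<h n}. measure M (sym_diff A (\<Union>i\<in>S. L n i)) < \<epsilon>"
proof -
  obtain F where F: "finite F" "F \<subseteq> {L n k | n k. k < h n}"
    "measure M (sym_diff A (\<Union>F)) < \<epsilon>"
    using levels_dense[OF A e] by blast
  have "\<exists>N. \<forall>X\<in>F. \<exists>n\<le>N. \<exists>k<h n. X = L n k"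
    using F(1,2)
  proof (induction F)
    case (insert X F)
    then obtain N where N: "\<forall>X\<in>F. \<exists>n\<le>N. \<exists>k<h n. X = L n k" by auto
    obtain n k where "k < h n" "X = L n k" using insert.prems by blast
    then have "\<forall>Y\<in>insert X F. \<exists>n'\<le>max N n. \<exists>k<h n'. Y = L n' k"
      using N by (metis insertE max.cobounded2 max.coboundedI1)
    then show ?case by blast
  qed auto
  then obtain N where N: "\<And>X. X \<in> F \<Longrightarrow> \<exists>n\<le>N. \<exists>k<h n. X = L n k" by blast
  show ?thesis
  proof (intro exI[of _ N] allI impI)
    fix n assume n: "n \<ge> N"
    define S where "S = {i. i < h n \<and> L n i \<subseteq> \<Union>F}"
    have "\<Union>F \<subseteq> (\<Union>i\<in>S. L n i)"
    proof
      fix x assume "x \<in> \<Union>F"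
      then obtain X where X: "X \<in> F" "x \<in> X" by blast
      obtain m k where m: "m \<le> N" "k < h m" "X = L m k" using N[OF X(1)] by blast
      obtain I where I: "\<forall>i\<in>I. i + h m \<le> h n" "\<forall>k. L m k = (\<Union>i\<in>I. L n (i + k))"
        using level_decomposition_exists[of m n] m n by auto
      then obtain i where i: "i \<in> I" "x \<in> L n (i + k)" using X m by blast
      have "i + k < h n" using I(1) i(1) m(2) by fastforce
      moreover have "L n (i + k) \<subseteq> \<Union>F" using X m I(2) i(1) by blast
      ultimately show "x \<in> (\<Union>i\<in>S. L n i)" using i by (auto simp: S_def)
    qed
    then have "(\<Union>i\<in>S. L n i) = \<Union>F" by (auto simp: S_def)
    then show "\<exists>S\<subseteq>{..<h n}. measure M (sym_diff A (\<Union>i\<in>S. L n i)) < \<epsilon>"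
      using F(3) by (intro exI[of _ S]) (auto simp: S_def)
  qed
qed

lemma tower_exhausts:
  assumes e: "\<epsilon> > 0"
  shows "\<exists>N. \<forall>n\<ge>N. measure M (space M - tower n) < \<epsilon>"
proof -
  interpret prob_space M by (rule prob_space_M)
  obtain N where N: "\<And>n. n \<ge> N \<Longrightarrow> \<exists>S\<subseteq>{..<h n}. measure M (sym_diff (space M) (\<Union>i\<in>S. L n i)) < \<epsilon>"
    using approximation_at_stage[OF sets.top e] by blast
  show ?thesis
  proof (intro exI[of _ N] allI impI)
    fix n assume "n \<ge> N"
    then obtain S where S: "S \<subseteq> {..<h n}" "measure M (sym_diff (space M) (\<Union>i\<in>S. L n i)) < \<epsilon>"
      using N by blast
    have "(\<Union>i\<in>S. L n i) \<in> sets M"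
      using S(1) level_measurable finite_subset[OF S(1)] by (intro sets.finite_UN) auto
    then have "measure M (space M - tower n) \<le> measure M (sym_diff (space M) (\<Union>i\<in>S. L n i))"
      using S(1) by (intro finite_measure_mono) (auto simp: tower_def)
    then show "measure M (space M - tower n) < \<epsilon>" using S by simp
  qed
qed

lemma base_nonempty: "B n \<noteq> {}"
proof
  assume *: "B n = {}"
  interpret prob_space M by (rule prob_space_M)
  obtain N where N: "\<And>n. n \<ge> N \<Longrightarrow> measure M (space M - tower n) < 1"
    using tower_exhausts[of 1] by auto
  have "B (max n N) = {}" using base_antimono[of n "max n N"] * by auto
  then have "tower (max n N) = {}" by (simp add: tower_def tower_level_def)
  then show False using N[of "max n N"] by (simp add: prob_space)
qed

lemma level_decomposition:
  assumes "m \<le> n"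
  shows "i \<in> tower_indices T r s B m n \<Longrightarrow> i + h m \<le> h n"
    and "L m k = (\<Union>i\<in>tower_indices T r s B m n. L n (i + k))"
proof -
  obtain I where I: "\<forall>i\<in>I. i + h m \<le> h n" "\<forall>k. L m k = (\<Union>i\<in>I. L n (i + k))"
    using level_decomposition_exists[OF assms] by blast
  have B: "B m = (\<Union>i\<in>I. L n i)" using I(2)[rule_format, of 0] by (simp add: level_0)
  have Ih: "i < h n" if "i \<in> I" for i using I(1) that height_pos[of m] by fastforce
  have "tower_indices T r s B m n = I"
  proof (intro set_eqI iffI)
    fix i assume "i \<in> tower_indices T r s B m n"
    then have i: "i < h n" "L n i \<subseteq> B m" by (auto simp: tower_indices_def)
    obtain x where x: "x \<in> L n i" using base_nonempty[of n] by (auto simp: tower_level_def)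
    then obtain j where "j \<in> I" "x \<in> L n j" using i B by blast
    then show "i \<in> I" using level_unique[OF x] i Ih by blast
  next
    fix i assume "i \<in> I"
    then show "i \<in> tower_indices T r s B m n" using Ih B by (auto simp: tower_indices_def)
  qed
  then show "i \<in> tower_indices T r s B m n \<Longrightarrow> i + h m \<le> h n"
    and "L m k = (\<Union>i\<in>tower_indices T r s B m n. L n (i + k))" using I by auto
qed

text \<open>Cover the space by sets $A_i$ of measure less than $\delta/2$, and approximate each by levels of
  stage $n$. A level of measure at least $\delta$ is too large to be part of any of the
  approximations, so it nearly misses every $A_i$, which is absurd.\<close>

lemma levels_small:
  assumes d: "\<delta> > 0"
  shows "\<exists>N. \<forall>n\<ge>N. \<forall>k<h n. measure M (L n k) < \<delta>"
proof -
  interpret prob_space M by (rule prob_space_M)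
  obtain K where K: "K > 0" "1 / real K < \<delta> / 2"
    using reals_Archimedean[of "\<delta>/2"] d by (auto simp: inverse_eq_divide intro: that[of "Suc _"])
  obtain A where A: "\<And>i. i < K \<Longrightarrow> A i \<in> sets M" "\<And>i. i < K \<Longrightarrow> measure M (A i) \<le> 1 / K"
    "AE x in M. \<exists>i<K. x \<in> A i"
    using standard_lebesgue_small_cover[OF standard_lebesgue K(1)] by blast
  \<comment> \<open>The error must be at most \<open>\<delta> / 2\<close> for one set, and at most \<open>\<delta>\<close> when summed over the \<open>K\<close> sets.\<close>
  define \<epsilon> where "\<epsilon> = \<delta> / (2 * K)"
  have e: "\<epsilon> > 0" using d K by (simp add: \<epsilon>_def)
  have "\<forall>i\<in>{..<K}. \<exists>N. \<forall>n\<ge>N. \<exists>S\<subseteq>{..<h n}. measure M (sym_diff (A i) (\<Union>i\<in>S. L n i)) < \<epsilon>"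
    using approximation_at_stage[OF A(1) e] by blast
  then obtain N where N: "\<And>i n. i < K \<Longrightarrow> n \<ge> N i \<Longrightarrow>
      \<exists>S\<subseteq>{..<h n}. measure M (sym_diff (A i) (\<Union>i\<in>S. L n i)) < \<epsilon>"
    by (metis lessThan_iff)
  show ?thesis
  proof (intro exI[of _ "\<Sum>i<K. N i"] allI impI)
    fix n k assume n: "n \<ge> (\<Sum>i<K. N i)" and k: "k < h n"
    have Lk: "L n k \<in> sets M" using level_measurable k .
    show "measure M (L n k) < \<delta>"
    proof (rule ccontr)
      assume "\<not> ?thesis"
      then have big: "measure M (L n k) \<ge> \<delta>" by simp
      have small: "measure M (L n k \<inter> A i) < \<epsilon>" if i: "i < K" for i
      proof -
        have "N i \<le> (\<Sum>i<K. N i)" using i by (intro member_le_sum) auto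
        then have "N i \<le> n" using n by (rule order_trans)
        then obtain S where S: "S \<subseteq> {..<h n}" "measure M (sym_diff (A i) (\<Union>i\<in>S. L n i)) < \<epsilon>"
          using N[OF i] by blast
        define Y where "Y = (\<Union>i\<in>S. L n i)"
        have Y: "Y \<in> sets M" unfolding Y_def
          using S(1) level_measurable finite_subset[OF S(1)] by (intro sets.finite_UN) auto
        have SD: "sym_diff (A i) Y \<in> sets M" using Y A(1)[OF i] by auto
        have "k \<notin> S"
        proof
          assume "k \<in> S"
          then have "L n k \<subseteq> A i \<union> sym_diff (A i) Y" by (auto simp: Y_def)
          then have "measure M (L n k) \<le> measure M (A i \<union> sym_diff (A i) Y)"
            using A(1)[OF i] SD by (intro finite_measure_mono) auto
          also have "\<dots> \<le> measure M (A i) + measure M (sym_diff (A i) Y)"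
            using A(1)[OF i] SD by (intro measure_Un_le) auto
          also have "\<dots> < \<delta> / 2 + \<epsilon>" using A(2)[OF i] S K by (simp add: Y_def)
          also have "\<dots> \<le> \<delta>" using K d by (simp add: \<epsilon>_def field_simps)
          finally show False using big by simp
        qed
        then have "L n k \<inter> Y = {}" unfolding Y_def using level_unique[of _ n k] k S(1) by blast
        then have "L n k \<inter> A i \<subseteq> sym_diff (A i) Y" by blast
        then have "measure M (L n k \<inter> A i) \<le> measure M (sym_diff (A i) Y)"
          using SD by (intro finite_measure_mono) auto
        then show ?thesis using S by (simp add: Y_def)
      qed
      have "measure M (L n k) \<le> measure M (\<Union>i<K. L n k \<inter> A i)"
      proof (rule finite_measure_mono_AE)
        show "AE x in M. x \<in> L n k \<longrightarrow> x \<in> (\<Union>i<K. L n k \<inter> A i)"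
          using A(3) by eventually_elim auto
      qed (use A Lk in auto)
      also have "\<dots> \<le> (\<Sum>i<K. measure M (L n k \<inter> A i))"
        using A Lk by (intro measure_UNION_le) auto
      also have "\<dots> < (\<Sum>i<K. \<epsilon>)" using K small by (intro sum_strict_mono) auto
      also have "\<dots> \<le> \<delta>" using K d by (simp add: \<epsilon>_def)
      finally show False using big by simp
    qed
  qed
qed

text \<open>A point that enters $L_{n,k+1}$ under $T$ without coming from $L_{n,k}$ must lie, for every later
  stage $q$, in the top level of stage $q$ or outside the tower of stage $q$: from any other
  level of stage $q$, the map $T$ leads to the next one, and the stage-$q$ levels that make up
  $L_{n,k+1}$ are the successors of those that make up $L_{n,k}$. Both exceptional sets have
  arbitrarily small measure.\<close>

lemma level_vimage_AE:
  assumes k: "Suc k < h n"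
  shows "AE x in M. x \<in> L n k \<longleftrightarrow> T x \<in> L n (Suc k)"
proof -
  interpret prob_space M by (rule prob_space_M)
  have m: "T \<in> measurable M M" using T_preserving by (simp add: measure_preserving_def)
  define E where "E = (T -` L n (Suc k) \<inter> space M) - L n k"
  have Es: "E \<in> sets M" unfolding E_def
    using measurable_sets[OF m level_measurable[OF k]] level_measurable[of k n] k by auto
  have "measure M E \<le> 2 * \<epsilon>" if e: "\<epsilon> > 0" for \<epsilon>
  proof -
    obtain N1 where N1: "\<And>n. n \<ge> N1 \<Longrightarrow> measure M (space M - tower n) < \<epsilon>"
      using tower_exhausts[OF e] by blast
    obtain N2 where N2: "\<And>n k. n \<ge> N2 \<Longrightarrow> k < h n \<Longrightarrow> measure M (L n k) < \<epsilon>"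
      using levels_small[OF e] by blast
    define q where "q = max n (max N1 N2)"
    define t where "t = h q - 1"
    have t: "t < h q" using height_pos[of q] by (simp add: t_def)
    have "E \<subseteq> (space M - tower q) \<union> L q t"
    proof
      fix x assume x: "x \<in> E"
      show "x \<in> (space M - tower q) \<union> L q t"
      proof (rule ccontr)
        assume "\<not> ?thesis"
        then obtain i where i: "i < h q" "x \<in> L q i" "i \<noteq> t" using x by (auto simp: E_def tower_def)
        then have i1: "Suc i < h q" by (simp add: t_def)
        obtain j where j: "j \<in> tower_indices T r s B n q" "T x \<in> L q (j + Suc k)"
          using x level_decomposition(2)[of n q "Suc k"] by (auto simp: E_def q_def)
        have "j + h n \<le> h q" using level_decomposition(1)[OF _ j(1)] by (simp add: q_def)
        then have "j + Suc k < h q" using k by simp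
        then have "j + Suc k = Suc i" using level_unique[OF j(2) T_level[OF i(2)]] i1 by simp
        then have "x \<in> L n k"
          using level_decomposition(2)[of n q k] i(2) j(1) by (auto simp: q_def)
        then show False using x by (simp add: E_def)
      qed
    qed
    then have "measure M E \<le> measure M ((space M - tower q) \<union> L q t)"
      using level_measurable[OF t] by (intro finite_measure_mono) auto
    also have "\<dots> \<le> measure M (space M - tower q) + measure M (L q t)"
      using level_measurable[OF t] by (intro measure_Un_le) auto
    also have "\<dots> \<le> \<epsilon> + \<epsilon>" using N1[of q] N2[of q t] t by (intro add_mono less_imp_le) (auto simp: q_def)
    finally show ?thesis by simp
  qed
  from this[of "measure M E / 4"] have "measure M E = 0"
    using measure_nonneg[of M E] by linarith
  then have "E \<in> null_sets M" using Es by (auto simp: null_sets_def emeasure_eq_measure)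
  then have "AE x in M. x \<notin> E" by (rule AE_not_in)
  then show ?thesis using AE_space
  proof eventually_elim
    case (elim x)
    then show ?case using T_level[of x n k] by (auto simp: E_def)
  qed
qed

lemma level_measure: "k < h n \<Longrightarrow> measure M (L n k) = measure M (B n)"
proof (induction k)
  case 0
  then show ?case by (simp add: level_0)
next
  case (Suc k)
  have "measure M (L n k) = measure M (L n (Suc k))"
    using Suc.prems level_measurable[of k n] level_measurable[of "Suc k" n]
    by (intro measure_preserving_measure_eq[OF prob_space_M T_preserving _ _ level_vimage_AE])
      (auto simp del: tower_height.simps)
  then show ?case using Suc by simp
qed

lemma measure_levels:
  assumes "S \<subseteq> {..<h n}"
  shows "(\<Union>i\<in>S. L n i) \<in> sets M" and "measure M (\<Union>i\<in>S. L n i) = card S * measure M (B n)"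
proof -
  interpret prob_space M by (rule prob_space_M)
  have fin: "finite S" using assms finite_subset by blast
  show "(\<Union>i\<in>S. L n i) \<in> sets M"
    using fin assms level_measurable by (intro sets.finite_UN) auto
  have "disjoint_family_on (L n) S"
    using levels_disjoint[of n] assms by (rule_tac disjoint_family_on_mono) auto
  then have "measure M (\<Union>i\<in>S. L n i) = (\<Sum>i\<in>S. measure M (L n i))"
    using fin assms level_measurable by (intro finite_measure_finite_Union) auto
  also have "\<dots> = (\<Sum>i\<in>S. measure M (B n))"
    using assms by (intro sum.cong refl level_measure) auto
  finally show "measure M (\<Union>i\<in>S. L n i) = card S * measure M (B n)" by simp
qed

lemma tower_indices_bounded: "tower_indices T r s B m n \<subseteq> {..<h n}"
  by (auto simp: tower_indices_def)

lemma base_measure: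
  assumes "m \<le> n"
  shows "measure M (B m) = card (tower_indices T r s B m n) * measure M (B n)"
proof -
  have "B m = (\<Union>i\<in>tower_indices T r s B m n. L n i)"
    using level_decomposition(2)[OF assms, of 0] by (simp add: level_0)
  then show ?thesis using measure_levels(2)[OF tower_indices_bounded, of n m] by metis
qed

lemma height_base_measure_le_1: "h n * measure M (B n) \<le> 1"
proof -
  interpret prob_space M by (rule prob_space_M)
  show ?thesis using measure_levels(2)[of "{..<h n}" n] prob_le_1[of "\<Union>i<h n. L n i"] by simp
qed


section \<open>From a cyclic factor to concentrated index sets\<close>

text \<open>The sets \<open>D j\<close> play the role of the fibres of a map to $\mathbb{Z}/k\mathbb{Z}$, indexed by all
  natural numbers in order to avoid reductions modulo $k$.\<close>

lemma level_inter_measure: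
  assumes D: "\<And>j. D j \<in> sets M" and ae: "\<And>j. AE x in M. x \<in> D j \<longleftrightarrow> T x \<in> D (Suc j)"
    and i: "i < h n"
  shows "measure M (L n i \<inter> D (j + i)) = measure M (B n \<inter> D j)"
  using i
proof (induction i)
  case 0
  then show ?case by (simp add: level_0)
next
  case (Suc i)
  have i: "i < h n" using Suc.prems by simp
  have "measure M (L n i \<inter> D (j + i)) = measure M (L n (Suc i) \<inter> D (Suc (j + i)))"
  proof (rule measure_preserving_measure_eq[OF prob_space_M T_preserving])
    show "AE x in M. x \<in> L n i \<inter> D (j + i) \<longleftrightarrow> T x \<in> L n (Suc i) \<inter> D (Suc (j + i))"
      using level_vimage_AE[OF Suc.prems] ae[of "j + i"] by eventually_elim auto
  qed (use D level_measurable[OF i] level_measurable[OF Suc.prems] in auto)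
  then show ?case using Suc.IH[OF i] by simp
qed

lemma base_concentrated:
  assumes D: "\<And>j. D j \<in> sets M" and ae: "\<And>j. AE x in M. x \<in> D j \<longleftrightarrow> T x \<in> D (Suc j)"
    and k: "k > 0" and periodic: "\<And>j. D j = D (j mod k)"
    and pos: "measure M (D 0) > 0" and eta: "\<eta> > 0"
  shows "\<exists>N. \<forall>n\<ge>N. \<exists>j<k. measure M (B n - D j) < \<eta> * measure M (B n)"
proof -
  interpret prob_space M by (rule prob_space_M)
  \<comment> \<open>If \<open>Y\<close> approximates \<open>D 0\<close> with error \<open>\<delta>\<close> and every level in \<open>Y\<close> has a proportion \<open>\<eta>\<close> outside \<open>D 0\<close>,
    then \<open>\<eta> * \<mu>(Y) \<le> \<delta>\<close>, hence \<open>\<eta> * \<mu>(D 0) \<le> (1 + \<eta>) * \<delta>\<close>; this \<open>\<epsilon>\<close> excludes \<open>\<delta> < \<epsilon>\<close>.\<close>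
  define \<epsilon> where "\<epsilon> = \<eta> * measure M (D 0) / (1 + \<eta>)"
  have e: "\<epsilon> > 0" using pos eta by (simp add: \<epsilon>_def)
  obtain N where N: "\<And>n. n \<ge> N \<Longrightarrow> \<exists>S\<subseteq>{..<h n}. measure M (sym_diff (D 0) (\<Union>i\<in>S. L n i)) < \<epsilon>"
    using approximation_at_stage[OF D e] by blast
  have "\<exists>j<k. measure M (B n - D j) < \<eta> * measure M (B n)" if n: "n \<ge> N" for n
  proof (rule ccontr)
    assume "\<not> ?thesis"
    then have spread: "\<eta> * measure M (B n) \<le> measure M (B n - D (j mod k))" for j
      using k by (meson mod_less_divisor not_less)
    obtain S where S: "S \<subseteq> {..<h n}" "measure M (sym_diff (D 0) (\<Union>i\<in>S. L n i)) < \<epsilon>"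
      using N[OF n] by blast
    define Y where "Y = (\<Union>i\<in>S. L n i)"
    have Y: "Y \<in> sets M" "measure M Y = card S * measure M (B n)"
      unfolding Y_def by (rule measure_levels[OF S(1)])+
    have SD: "sym_diff (D 0) Y \<in> sets M" using Y D by auto
    have level: "\<eta> * measure M (B n) \<le> measure M (L n i - D 0)" if i: "i < h n" for i
    proof -
      \<comment> \<open>A representative of \<open>-i\<close> modulo \<open>k\<close>.\<close>
      define j where "j = i * (k - 1)"
      have "j + i = i * k" using k by (cases k) (auto simp: j_def)
      then have "D (j + i) = D 0" using periodic[of "j + i"] by simp
      then have "measure M (L n i - D 0) = measure M (L n i) - measure M (B n \<inter> D j)"
        using level_inter_measure[of D i n j, OF D ae i] level_measurable[OF i] D
        by (simp add: finite_measure_Diff')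
      also have "\<dots> = measure M (B n - D j)"
        using level_measure[OF i] base_measurable D by (simp add: finite_measure_Diff')
      also have "\<dots> \<ge> \<eta> * measure M (B n)" using spread[of j] periodic[of j] by simp
      finally show ?thesis .
    qed
    have fin: "finite S" using S(1) finite_subset by blast
    have "card S * (\<eta> * measure M (B n)) \<le> (\<Sum>i\<in>S. measure M (L n i - D 0))"
      using S(1) level by (intro sum_bounded_below) auto
    also have "\<dots> = measure M (\<Union>i\<in>S. L n i - D 0)"
    proof (rule finite_measure_finite_Union[symmetric, OF fin])
      show "disjoint_family_on (\<lambda>i. L n i - D 0) S"
        using level_unique[of _ n] S(1) unfolding disjoint_family_on_def by blast
    qed (use S(1) level_measurable D in auto)
    also have "\<dots> \<le> measure M (sym_diff (D 0) Y)"
      using SD by (intro finite_measure_mono) (auto simp: Y_def)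
    finally have 1: "\<eta> * measure M Y \<le> measure M (sym_diff (D 0) Y)"
      by (simp add: Y(2) mult_ac)
    have "measure M (D 0) \<le> measure M (Y \<union> sym_diff (D 0) Y)"
      using Y SD by (intro finite_measure_mono) auto
    also have "\<dots> \<le> measure M Y + measure M (sym_diff (D 0) Y)"
      using Y SD by (intro measure_Un_le) auto
    finally have "\<eta> * measure M (D 0) \<le> \<eta> * measure M Y + \<eta> * measure M (sym_diff (D 0) Y)"
      using eta by (simp flip: distrib_left)
    also have "\<dots> \<le> (1 + \<eta>) * measure M (sym_diff (D 0) Y)"
      using 1 by (simp add: algebra_simps)
    also have "\<dots> < (1 + \<eta>) * \<epsilon>"
      using S(2) eta by (simp add: Y_def)
    finally show False using eta by (simp add: \<epsilon>_def)
  qed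
  then show ?thesis by blast
qed

lemma indices_concentrated_of_cyclic_partition:
  assumes D: "\<And>j. D j \<in> sets M" and ae: "\<And>j. AE x in M. x \<in> D j \<longleftrightarrow> T x \<in> D (Suc j)"
    and k: "k > 0" and periodic: "\<And>j. D j = D (j mod k)"
    and disj: "\<And>i j. i mod k \<noteq> j mod k \<Longrightarrow> D i \<inter> D j = {}"
    and pos: "measure M (D 0) > 0" and eta: "\<eta> > 0"
  shows "\<exists>N. \<forall>m n. N \<le> m \<and> m \<le> n \<longrightarrow> (\<exists>j\<in>{0..<k}.
      real (card {i \<in> tower_indices T r s B m n. i mod k \<noteq> j})
        / real (card (tower_indices T r s B m n)) < \<eta>)"
proof -
  interpret prob_space M by (rule prob_space_M)
  define \<eta>' where "\<eta>' = min (1 / 2) (\<eta> / 2)"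
  have eta': "\<eta>' > 0" using eta by (simp add: \<eta>'_def)
  obtain N where N: "\<And>n. n \<ge> N \<Longrightarrow> \<exists>j<k. measure M (B n - D j) < \<eta>' * measure M (B n)"
    using base_concentrated[of D k, OF D ae k periodic pos eta'] by blast
  have "\<exists>j\<in>{0..<k}. real (card {i \<in> tower_indices T r s B m n. i mod k \<noteq> j})
        / real (card (tower_indices T r s B m n)) < \<eta>" if mn: "N \<le> m" "m \<le> n" for m n
  proof -
    define I where "I = tower_indices T r s B m n"
    obtain a where a: "a < k" "measure M (B m - D a) < \<eta>' * measure M (B m)"
      using N mn by blast
    obtain b where b: "b < k" "measure M (B n - D b) < \<eta>' * measure M (B n)"
      using N mn by (meson order_trans)
    \<comment> \<open>The residue class of \<open>a - b\<close>.\<close>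
    define j where "j = (a + (k - b)) mod k"
    define J where "J = {i \<in> I. i mod k \<noteq> j}"
    have Ih: "i < h n" if "i \<in> I" for i using that tower_indices_bounded by (auto simp: I_def)
    have fin: "finite I" using tower_indices_bounded[of m n] finite_subset unfolding I_def by blast
    have off: "D (b + i) \<inter> D a = {}" if "i \<in> J" for i
    proof (rule disj, rule notI)
      assume "(b + i) mod k = a mod k"
      then have "(b + i + (k - b)) mod k = j" unfolding j_def by (metis mod_add_left_eq)
      moreover have "b + i + (k - b) = i + k" using b(1) by simp
      ultimately show False using that by (simp add: J_def)
    qed
    have half: "measure M (B n) / 2 \<le> measure M (L n i \<inter> D (b + i))" if "i < h n" for i
    proof -
      have "measure M (B n - D b) = measure M (B n) - measure M (B n \<inter> D b)"
        using base_measurable D by (intro finite_measure_Diff') auto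
      moreover have "\<eta>' * measure M (B n) \<le> 1 / 2 * measure M (B n)"
        by (intro mult_right_mono) (auto simp: \<eta>'_def)
      ultimately show ?thesis
        using level_inter_measure[of D i n b, OF D ae that] b(2) by simp
    qed
    have "card J * (measure M (B n) / 2) \<le> (\<Sum>i\<in>J. measure M (L n i \<inter> D (b + i)))"
      using half Ih by (intro sum_bounded_below) (auto simp: J_def)
    also have "\<dots> = measure M (\<Union>i\<in>J. L n i \<inter> D (b + i))"
    proof (rule finite_measure_finite_Union[symmetric])
      show "disjoint_family_on (\<lambda>i. L n i \<inter> D (b + i)) J"
        using level_unique[of _ n] Ih unfolding disjoint_family_on_def J_def by blast
      show "(\<lambda>i. L n i \<inter> D (b + i)) ` J \<subseteq> sets M"
        using level_measurable[OF Ih] D by (auto simp: J_def)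
    qed (use fin in \<open>auto simp: J_def\<close>)
    also have "\<dots> \<le> measure M (B m - D a)"
    proof (rule finite_measure_mono)
      show "(\<Union>i\<in>J. L n i \<inter> D (b + i)) \<subseteq> B m - D a"
        using off by (auto simp: J_def I_def tower_indices_def)
    qed (use base_measurable D in auto)
    also have "\<dots> < \<eta>' * measure M (B m)" by (rule a)
    also have "\<dots> = \<eta>' * card I * measure M (B n)"
      using base_measure[OF mn(2)] by (simp add: I_def)
    finally have *: "card J / 2 * measure M (B n) < \<eta>' * card I * measure M (B n)" by simp
    then have "card J / 2 < \<eta>' * card I"
      using measure_nonneg[of M "B n"] by (meson mult_right_mono not_le)
    moreover have "\<eta>' * card I \<le> \<eta> / 2 * card I"
      by (intro mult_right_mono) (auto simp: \<eta>'_def)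
    ultimately have "card J < \<eta> * card I" by simp
    moreover from this have "card I > 0" by (intro Nat.gr0I) auto
    ultimately have "card J / card I < \<eta>" by (simp add: field_simps)
    moreover have "j \<in> {0..<k}" using k by (simp add: j_def)
    ultimately show ?thesis unfolding J_def I_def by blast
  qed
  then show ?thesis by blast
qed

lemma indices_concentrated_if_factor:
  assumes k: "k > 0" and factor: "factors_onto M T (cyclic_space k) (cyclic_perm k)"
    and eta: "\<eta> > 0"
  shows "\<exists>N. \<forall>m n. N \<le> m \<and> m \<le> n \<longrightarrow> (\<exists>j\<in>{0..<k}.
      real (card {i \<in> tower_indices T r s B m n. i mod k \<noteq> j})
        / real (card (tower_indices T r s B m n)) < \<eta>)"
proof -
  obtain f A where A: "full_measure_set M A"
    and f: "measure_preserving (restrict_space M A) (cyclic_space k) f"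
    and ae: "AE x in M. f (T x) = cyclic_perm k (f x)"
    using factor unfolding factors_onto_def factor_map_def by blast
  define D where "D j = {x \<in> A. f x = j mod k}" for j
  have As: "A \<in> sets M" using A by (simp add: full_measure_set_def)
  have spA: "space (restrict_space M A) = A"
    using As by (rule space_restrict_space2)
  have fm: "f \<in> measurable (restrict_space M A) (cyclic_space k)"
    using f by (simp add: measure_preserving_def)
  have fk: "f x < k" if "x \<in> A" for x
    using measurable_space[OF fm, of x] that spA
    by (simp add: cyclic_space_def space_uniform_count_measure)
  have atom: "{j mod k} \<in> sets (cyclic_space k)" for j
    using k by (simp add: cyclic_space_def sets_uniform_count_measure)
  have D_vimage: "D j = f -` {j mod k} \<inter> space (restrict_space M A)" for j
    unfolding spA by (auto simp: D_def)
  have DA: "D j \<in> sets (restrict_space M A)" for j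
    unfolding D_vimage by (rule measurable_sets[OF fm atom])
  then have D: "D j \<in> sets M" for j using As by (simp add: sets_restrict_space_iff)
  have aeA: "AE x in M. x \<in> A" by (rule full_measure_set_AE[OF A])
  have aeTA: "AE x in M. T x \<in> A" by (rule measure_preserving_AE[OF T_preserving aeA])
  have aeD: "AE x in M. x \<in> D j \<longleftrightarrow> T x \<in> D (Suc j)" for j
    using aeA aeTA ae
  proof eventually_elim
    case (elim x)
    have "f x = j mod k \<longleftrightarrow> (f x + 1) mod k = Suc j mod k"
    proof
      assume "(f x + 1) mod k = Suc j mod k"
      then have "(f x + 1 + (k - 1)) mod k = (Suc j + (k - 1)) mod k" by (metis mod_add_left_eq)
      then show "f x = j mod k" using fk[OF elim(1)] k by simp
    qed (simp add: mod_Suc_eq)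
    then show ?case using elim by (auto simp: D_def cyclic_perm_def)
  qed
  have "emeasure M (D 0) = emeasure (restrict_space M A) (D 0)"
    using As by (subst emeasure_restrict_space) (auto simp: D_def)
  also have "\<dots> = emeasure (cyclic_space k) {0 mod k}"
    using f atom unfolding D_vimage measure_preserving_def by blast
  also have "\<dots> = ennreal (1 / k)"
    using k by (simp add: cyclic_space_def emeasure_uniform_count_measure)
  finally have "measure M (D 0) > 0" using k by (simp add: measure_def)
  then show ?thesis
    using k eta D aeD by (intro indices_concentrated_of_cyclic_partition[of D]) (auto simp: D_def)
qed

section \<open>From concentrated index sets to a cyclic factor\<close>

text \<open>The index of the level of stage \<open>n\<close> that contains \<open>x\<close>; arbitrary for points outside the
  tower. The least index is taken because this makes measurability immediate.\<close>

definition position :: "nat \<Rightarrow> 'a \<Rightarrow> nat" where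
  "position n x = (LEAST i. i < h n \<and> x \<in> L n i)"

lemma position_eq: "x \<in> L n i \<Longrightarrow> i < h n \<Longrightarrow> position n x = i"
  unfolding position_def by (rule Least_equality) (use level_unique in auto)

lemma position_measurable [measurable]: "position n \<in> measurable M (count_space UNIV)"
proof -
  have "Measurable.pred M (\<lambda>x. i < h n \<and> x \<in> L n i)" for i
    using level_measurable[of i n] by (cases "i < h n") auto
  then show ?thesis unfolding position_def by (rule measurable_Least)
qed

lemma factor_if_indices_concentrated:
  assumes k: "k > 0"
    and conc: "\<And>\<eta>::real. \<eta> > 0 \<Longrightarrow> \<exists>N. \<forall>m n. N \<le> m \<and> m \<le> n \<longrightarrow> (\<exists>j\<in>{0..<k}.
      real (card {i \<in> tower_indices T r s B m n. i mod k \<noteq> j})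
        / real (card (tower_indices T r s B m n)) < \<eta>)"
  shows "factors_onto M T (cyclic_space k) (cyclic_perm k)"
proof -
  interpret prob_space M by (rule prob_space_M)
  let ?I = "tower_indices T r s B"
  define e where "e t = (1 / 2 :: real) ^ t" for t
  have e: "e t > 0" for t by (simp add: e_def)
  define ok where "ok t m \<longleftrightarrow> measure M (space M - tower m) < e t \<and>
      (\<forall>l<h m. measure M (L m l) < e t) \<and>
      (\<forall>n\<ge>m. \<exists>j<k. card {i \<in> ?I m n. i mod k \<noteq> j} \<le> e t * card (?I m n))" for t m
  have "\<forall>t. \<exists>N. \<forall>m\<ge>N. ok t m"
  proof
    fix t
    obtain N1 where N1: "\<And>n. n \<ge> N1 \<Longrightarrow> measure M (space M - tower n) < e t"
      using tower_exhausts[OF e] by blast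
    obtain N2 where N2: "\<And>n k. n \<ge> N2 \<Longrightarrow> k < h n \<Longrightarrow> measure M (L n k) < e t"
      using levels_small[OF e] by blast
    obtain N3 where N3: "\<And>m n. N3 \<le> m \<Longrightarrow> m \<le> n \<Longrightarrow> \<exists>j\<in>{0..<k}.
        real (card {i \<in> ?I m n. i mod k \<noteq> j}) / real (card (?I m n)) < e t"
      using conc[OF e] by blast
    have "\<exists>j<k. card {i \<in> ?I m n. i mod k \<noteq> j} \<le> e t * card (?I m n)"
      if mn: "N3 \<le> m" "m \<le> n" for m n
    proof -
      obtain j where j: "j < k" "real (card {i \<in> ?I m n. i mod k \<noteq> j}) / real (card (?I m n)) < e t"
        using N3[OF mn] by auto
      have fin: "finite (?I m n)" using tower_indices_bounded finite_subset by blast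
      have "card {i \<in> ?I m n. i mod k \<noteq> j} \<le> e t * card (?I m n)"
      \<comment> \<open>An empty index set would satisfy the hypothesis through division by zero.\<close>
      proof (cases "card (?I m n) = 0")
        case True
        then show ?thesis using fin by auto
      next
        case False
        then show ?thesis using j(2) by (simp add: field_simps)
      qed
      then show ?thesis using j(1) by blast
    qed
    then show "\<exists>N. \<forall>m\<ge>N. ok t m"
      unfolding ok_def using N1 N2 by (intro exI[of _ "max N1 (max N2 N3)"]) auto
  qed
  then obtain N where "\<forall>t. \<forall>m\<ge>N t. ok t m" by (rule choice[THEN exE])
  then have N: "m \<ge> N t \<Longrightarrow> measure M (space M - tower m) < e t"
    "m \<ge> N t \<Longrightarrow> l < h m \<Longrightarrow> measure M (L m l) < e t"
    "m \<ge> N t \<Longrightarrow> n \<ge> m \<Longrightarrow>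
        \<exists>j<k. card {i \<in> ?I m n. i mod k \<noteq> j} \<le> e t * card (?I m n)" for t m l n
    unfolding ok_def by blast+
  \<comment> \<open>A monotone sequence of stages that are good for the errors \<open>e t\<close>.\<close>
  define \<nu> where "\<nu> t = (\<Sum>u\<le>t. N u)" for t
  have \<nu>N: "N t \<le> \<nu> t" for t unfolding \<nu>_def by (intro member_le_sum) auto
  have \<nu>S: "\<nu> t \<le> \<nu> (Suc t)" for t by (simp add: \<nu>_def)
  have "\<forall>t. \<exists>j<k. card {i \<in> ?I (\<nu> t) (\<nu> (Suc t)). i mod k \<noteq> j} \<le> e t * card (?I (\<nu> t) (\<nu> (Suc t)))"
    using N(3)[OF \<nu>N \<nu>S] by blast
  then obtain j where "\<forall>t. j t < k \<and>
      card {i \<in> ?I (\<nu> t) (\<nu> (Suc t)). i mod k \<noteq> j t} \<le> e t * card (?I (\<nu> t) (\<nu> (Suc t)))"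
    by (rule choice[THEN exE])
  then have j: "j t < k"
    "card {i \<in> ?I (\<nu> t) (\<nu> (Suc t)). i mod k \<noteq> j t} \<le> e t * card (?I (\<nu> t) (\<nu> (Suc t)))" for t
    by blast+
  \<comment> \<open>Points of position \<open>l\<close> at stage \<open>\<nu> t\<close> mostly have position congruent to \<open>l + j t\<close> at stage
    \<open>\<nu> (Suc t)\<close>; the shifts \<open>c\<close> compensate for this, adding \<open>k - j t\<close> in place of \<open>- j t\<close>.\<close>
  define c where "c t = (\<Sum>u<t. k - j u)" for t
  define \<phi> where "\<phi> t x = (position (\<nu> t) x + c t) mod k" for t x
  have [measurable]: "\<phi> t \<in> measurable M (count_space UNIV)" for t
    unfolding \<phi>_def by measurable
  define J where "J t = {i \<in> ?I (\<nu> t) (\<nu> (Suc t)). i mod k \<noteq> j t}" for t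
  define top where "top t = h (\<nu> t) - 1" for t
  have top: "top t < h (\<nu> t)" for t using height_pos[of "\<nu> t"] by (simp add: top_def)
  define W where "W t = (\<Union>l<h (\<nu> t). \<Union>i\<in>J t. L (\<nu> (Suc t)) (i + l))" for t
  \<comment> \<open>Outside \<open>E t\<close> the colouring \<open>\<phi> t\<close> advances by \<open>1\<close> under \<open>T\<close> and agrees with \<open>\<phi> (Suc t)\<close>.\<close>
  define E where "E t = (space M - tower (\<nu> t)) \<union> (L (\<nu> t) (top t) \<union> W t)" for t
  have Jh: "i + l < h (\<nu> (Suc t))" if "i \<in> J t" "l < h (\<nu> t)" for i l t
    using level_decomposition(1)[OF \<nu>S, of i t] that by (auto simp: J_def)
  have finJ: "finite (J t)" for t
    using finite_subset[OF tower_indices_bounded[of "\<nu> t" "\<nu> (Suc t)"]] by (simp add: J_def)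
  have W: "W t \<in> sets M" "measure M (W t) \<le> e t" for t
  proof -
    define w where "w = measure M (B (\<nu> (Suc t)))"
    have sets: "(\<Union>i\<in>J t. L (\<nu> (Suc t)) (i + l)) \<in> sets M" if "l < h (\<nu> t)" for l
      using finJ level_measurable[OF Jh[OF _ that]] by (intro sets.finite_UN) auto
    show "W t \<in> sets M" unfolding W_def by (rule sets.finite_UN) (use sets in auto)
    have "measure M (W t) \<le> (\<Sum>l<h (\<nu> t). measure M (\<Union>i\<in>J t. L (\<nu> (Suc t)) (i + l)))"
      unfolding W_def using sets by (intro measure_UNION_le) auto
    also have "\<dots> \<le> (\<Sum>l<h (\<nu> t). \<Sum>i\<in>J t. measure M (L (\<nu> (Suc t)) (i + l)))"
      using finJ level_measurable[OF Jh] by (intro sum_mono measure_UNION_le) auto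
    also have "\<dots> = (\<Sum>l<h (\<nu> t). \<Sum>i\<in>J t. w)"
      unfolding w_def by (intro sum.cong refl level_measure Jh) auto
    also have "\<dots> = h (\<nu> t) * (card (J t) * w)" by simp
    also have "\<dots> \<le> h (\<nu> t) * (e t * card (?I (\<nu> t) (\<nu> (Suc t))) * w)"
      using j(2)[of t] unfolding J_def w_def
      by (intro mult_left_mono mult_right_mono) auto
    also have "\<dots> = e t * (h (\<nu> t) * measure M (B (\<nu> t)))"
      using base_measure[OF \<nu>S, of t] by (simp add: w_def)
    also have "\<dots> \<le> e t * 1"
      using e[of t] by (intro mult_left_mono height_base_measure_le_1) auto
    finally show "measure M (W t) \<le> e t" by simp
  qed
  have Es: "E t \<in> sets M" for t
    unfolding E_def using W level_measurable[OF top] by auto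
  have E_le: "measure M (E t) \<le> 3 * e t" for t
  proof -
    have "measure M (E t) \<le> measure M (space M - tower (\<nu> t)) + measure M (L (\<nu> t) (top t) \<union> W t)"
      unfolding E_def using W level_measurable[OF top] by (intro measure_Un_le) auto
    also have "measure M (L (\<nu> t) (top t) \<union> W t) \<le> measure M (L (\<nu> t) (top t)) + measure M (W t)"
      using W level_measurable[OF top] by (intro measure_Un_le) auto
    finally show ?thesis
      using N(1)[OF \<nu>N[of t]] N(2)[OF \<nu>N top[of t]] W(2)[of t] by linarith
  qed
  have "summable (\<lambda>t. measure M (E t))"
  proof (rule summable_comparison_test')
    show "summable (\<lambda>t. 3 * e t)" unfolding e_def by (intro summable_mult summable_geometric) simp
    show "norm (measure M (E t)) \<le> 3 * e t" for t using E_le[of t] by simp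
  qed
  then have bc: "AE x in M. \<forall>\<^sub>F t in sequentially. x \<in> space M - E t"
    using Es by (intro borel_cantelli_AE1) (auto simp: emeasure_eq_measure)
  have good: "\<phi> (Suc t) x = \<phi> t x \<and> \<phi> t (T x) = (\<phi> t x + 1) mod k"
    if x: "x \<in> space M - E t" for t x
  proof -
    obtain l where l: "l < h (\<nu> t)" "x \<in> L (\<nu> t) l" "l \<noteq> top t"
      using x by (auto simp: E_def tower_def)
    have l1: "Suc l < h (\<nu> t)" using l by (simp add: top_def)
    have pos: "\<phi> t x = (l + c t) mod k" using position_eq[OF l(2,1)] by (simp add: \<phi>_def)
    obtain i where i: "i \<in> ?I (\<nu> t) (\<nu> (Suc t))" "x \<in> L (\<nu> (Suc t)) (i + l)"
      using l(2) level_decomposition(2)[OF \<nu>S, of t l] by blast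
    have "i \<notin> J t" using x i(2) l(1) by (auto simp: E_def W_def)
    then have ij: "i mod k = j t" using i(1) by (simp add: J_def)
    have "i + l < h (\<nu> (Suc t))" using level_decomposition(1)[OF \<nu>S i(1)] l(1) by simp
    then have "\<phi> (Suc t) x = (i + l + (c t + (k - j t))) mod k"
      using position_eq[OF i(2)] by (simp add: \<phi>_def c_def)
    also have "i + l + (c t + (k - j t)) = l + c t + (i div k + 1) * k"
    proof -
      have "i = i div k * k + j t" using ij by (metis div_mult_mod_eq)
      then have "i + (k - j t) = (i div k + 1) * k" using j(1)[of t] by simp
      then show ?thesis by simp
    qed
    also have "\<dots> mod k = \<phi> t x" unfolding pos by (rule mod_mult_self1)
    finally have "\<phi> (Suc t) x = \<phi> t x" .
    moreover have "\<phi> t (T x) = (\<phi> t x + 1) mod k"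
      using position_eq[OF T_level[OF l(2)] l1] unfolding pos by (simp add: \<phi>_def mod_Suc_eq)
    ultimately show ?thesis by blast
  qed
  \<comment> \<open>The colours are discrete, so convergence means being eventually constant.\<close>
  define lm where "lm x v \<longleftrightarrow> (\<forall>\<^sub>F t in sequentially. \<phi> t x = v)" for x v
  define f where "f x = (THE v. lm x v)" for x
  have f_eq: "f x = v" if "lm x v" for x v
    unfolding f_def
  proof (rule the_equality)
    show "lm x v" by (rule that)
    fix u assume "lm x u"
    then have "\<forall>\<^sub>F t in sequentially. u = v"
      using that unfolding lm_def by eventually_elim simp
    then show "u = v" by simp
  qed
  define A where "A = {x \<in> space M. \<exists>v<k. lm x v}"
  have lms: "{x \<in> space M. lm x v} \<in> sets M" for v
    unfolding lm_def eventually_sequentially by measurable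
  have As: "A \<in> sets M"
  proof -
    have "A = (\<Union>v<k. {x \<in> space M. lm x v})" by (auto simp: A_def)
    then show ?thesis using lms by auto
  qed
  have ae: "AE x in M. x \<in> A \<and> f (T x) = cyclic_perm k (f x)"
    using bc AE_space
  proof eventually_elim
    case (elim x)
    then obtain t0 where t0: "\<And>t. t \<ge> t0 \<Longrightarrow> x \<in> space M - E t"
      by (auto simp: eventually_sequentially)
    define v where "v = \<phi> t0 x"
    have v: "\<phi> t x = v" if "t \<ge> t0" for t
      using that
    proof (induction t rule: dec_induct)
      case (step t)
      then show ?case using good[OF t0[of t]] by simp
    qed (simp add: v_def)
    have "lm x v" unfolding lm_def eventually_sequentially using v by blast
    moreover have "lm (T x) ((v + 1) mod k)"
      unfolding lm_def eventually_sequentially using good[OF t0] v by (intro exI[of _ t0]) simp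
    moreover have "v < k" using k by (simp add: v_def \<phi>_def)
    ultimately show ?case
      using elim(2) by (auto simp: A_def cyclic_perm_def f_eq)
  qed
  have full: "full_measure_set M A"
    unfolding full_measure_set_def
  proof
    have "AE x in M. x \<notin> space M - A" using ae by eventually_elim auto
    then show "emeasure M (space M - A) = 0" using As by (subst (asm) AE_iff_null_sets[symmetric]) auto
  qed (rule As)
  have spA: "space (restrict_space M A) = A"
    using As by (rule space_restrict_space2)
  have fm: "f \<in> measurable (restrict_space M A) (count_space {0..<k})"
  proof (rule measurable_count_space_eq2[THEN iffD2], simp, intro conjI ballI)
    show "f \<in> space (restrict_space M A) \<rightarrow> {0..<k}"
      unfolding spA by (auto simp: A_def f_eq)
    fix v assume "v \<in> {0..<k}"
    then have "f -` {v} \<inter> A = {x \<in> space M. lm x v}"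
      by (auto simp: A_def f_eq)
    then show "f -` {v} \<inter> space (restrict_space M A) \<in> sets (restrict_space M A)"
      unfolding spA using lms[of v] As by (auto simp: sets_restrict_space_iff)
  qed
  have "AE x in M. f (T x) = cyclic_perm k (f x)" using ae by eventually_elim simp
  then show ?thesis by (rule factors_onto_cyclicI[OF prob_space_M T_preserving k full fm])
qed

end

theorem corollary3p2:
  fixes M :: "'a measure"
    and T :: "'a \<Rightarrow> 'a"
    and r :: "nat \<Rightarrow> nat"
    and s :: "nat \<Rightarrow> nat \<Rightarrow> nat"
    and B :: "nat \<Rightarrow> 'a set"
    and P :: "nat \<Rightarrow> nat \<Rightarrow> 'a set"
    and C :: "nat \<Rightarrow> nat \<Rightarrow> nat \<Rightarrow> 'a set"
  assumes "rank_one_transformation M T r s B P C"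
  shows "(\<exists>k::nat. k > 1 \<and> factors_onto M T (cyclic_space k) (cyclic_perm k))
     \<longleftrightarrow> (\<exists>k::nat. k > 1 \<and>
            (\<forall>\<eta>::real. \<eta> > 0 \<longrightarrow>
              (\<exists>N::nat. \<forall>m n. N \<le> m \<and> m \<le> n \<longrightarrow>
                (\<exists>j\<in>{0..<k}.
                  real (card {i \<in> tower_indices T r s B m n. i mod k \<noteq> j})
                    / real (card (tower_indices T r s B m n)) < \<eta>))))"
proof -
  interpret rank_one_transformation M T r s B P C by fact
  have "factors_onto M T (cyclic_space k) (cyclic_perm k) \<longleftrightarrow>
            (\<forall>\<eta>::real. \<eta> > 0 \<longrightarrow>
              (\<exists>N::nat. \<forall>m n. N \<le> m \<and> m \<le> n \<longrightarrow>
                (\<exists>j\<in>{0..<k}.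
                  real (card {i \<in> tower_indices T r s B m n. i mod k \<noteq> j})
                    / real (card (tower_indices T r s B m n)) < \<eta>)))"
    (is "_ \<longleftrightarrow> ?concentrated k") if "k > 1" for k
  proof
    assume "factors_onto M T (cyclic_space k) (cyclic_perm k)"
    then show "?concentrated k" using indices_concentrated_if_factor[of k] that by simp
  next
    assume "?concentrated k"
    then show "factors_onto M T (cyclic_space k) (cyclic_perm k)"
      using that by (intro factor_if_indices_concentrated) auto
  qed
  then show ?thesis by meson
qed

end
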